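(* Let $\Omega$ be a finite set and let $P$ be a strongly regular partition of $\mathcal{P}(\Omega)$. Then for any three blocs $\mathsf{B}_i$, $\mathsf{B}_j$ and $\mathsf{B}_k$ of $P$, and any integers $r_1,r_2,r_3,r_4$, the number $$\Big|\big\{(A,B)\in\mathsf{B}_i\times\mathsf{B}_j \;:\; |A\cap B|=r_1,\ |A\cap C|=r_2,\ |B\cap C|=r_3,\ |A\cap B\cap C|=r_4\big\}\Big|$$ is independent of the choice of $C$ in $\mathsf{B}_k$.
   Context: $\mathcal{P}(\Omega)$ is the powerset of $\Omega$. A strongly regular partition of $\mathcal{P}(\Omega)$ is a partition of $\mathcal{P}(\Omega)$ into (nonempty) blocs $\mathsf{B}_1,\ldots,\mathsf{B}_s$ such that: (1) all sets in a given bloc have the same size; (2) for any bloc $\mathsf{B}_i$, the set of all complements (in $\Omega$) of the members of $\mathsf{B}_i$ is also a bloc; (3) for any two blocs $\mathsf{B}_i$ and $\mathsf{B}_j$, the number of members of $\mathsf{B}_j$ that are included in a member $A$ of $\mathsf{B}_i$ is independent of the choice of $A$ in $\mathsf{B}_i$. *)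

theory Defs
  imports Complex_Main "HOL-Library.Disjoint_Sets"
begin

definition strongly_regular_partition :: "'a set \<Rightarrow> 'a set set set \<Rightarrow> bool" where
  "strongly_regular_partition \<Omega> P \<longleftrightarrow>
     partition_on (Pow \<Omega>) P \<and>
     (\<forall>\<B>\<in>P. \<forall>A\<in>\<B>. \<forall>A'\<in>\<B>. card A = card A') \<and>
     (\<forall>\<B>\<in>P. (\<lambda>A. \<Omega> - A) ` \<B> \<in> P) \<and>
     (\<forall>\<B>\<in>P. \<forall>\<C>\<in>P. \<forall>A\<in>\<B>. \<forall>A'\<in>\<B>.
        card {D \<in> \<C>. D \<subseteq> A} = card {D \<in> \<C>. D \<subseteq> A'})"

end

theory Submission
  imports Defs "HOL-Computational_Algebra.Polynomial"
begin

text \<open>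
  Consider the real functions on the powerset of \<open>\<Omega>\<close> that are constant on each bloc. They form an
  algebra under pointwise operations, and it contains the indicators of the blocs and every
  function of the size. Regularity makes it closed under summation over subsets, and complements
  carry this over to summation over supersets. Combining the two, the algebra is preserved by every
  operator whose kernel is \<open>p ^ card (A \<inter> D) * q ^ card (A - D)\<close>, acting from either side
  (\<open>bloc_constant_kernel_left\<close>, \<open>bloc_constant_kernel_right\<close>).

  The pairs \<open>(A, B)\<close> are counted with weight
  \<open>x ^ card (A \<inter> B) * y ^ card (A \<inter> C) * z ^ card (B \<inter> C) * v ^ card (A \<inter> B \<inter> C)\<close>. This weight is a
  triangle: it relates each two of the three sets directly, and operators that preserve the algebra
  do not compose to a triangle. They do compose to a star, in which \<open>A\<close>, \<open>B\<close> and \<open>C\<close> are each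
  related only to a fourth set \<open>D\<close>, over which one sums. Both expressions are products over the
  points of \<open>\<Omega>\<close>. The local factor of the triangle is a tensor of format \<open>2 \<times> 2 \<times> 2\<close>, indexed by
  membership of the point in \<open>A\<close>, \<open>B\<close> and \<open>C\<close>; that of the star is a sum of two rank-one tensors,
  one for the points in \<open>D\<close> and one for those outside. An open set of real \<open>2 \<times> 2 \<times> 2\<close> tensors has
  rank at most two, and for \<open>x, y, z > 1\<close> and every \<open>v\<close> the decomposition can be written down
  (\<open>two_point_joint_moments\<close>). Hence the triangle equals a star (\<open>star_triangle\<close>) and its sum over
  \<open>A\<close> and \<open>B\<close> in two blocs is constant as \<open>C\<close> varies in a bloc
  (\<open>generating_function_bloc_constant\<close>). This sum is a polynomial in \<open>x, y, z, v\<close> whose coefficients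
  are the required numbers, and a polynomial is determined by its values on an infinite grid.
\<close>

section \<open>Functions constant on blocs\<close>

definition bloc_constant :: "'a set set set \<Rightarrow> ('a set \<Rightarrow> real) \<Rightarrow> bool" where
  "bloc_constant P f \<longleftrightarrow> (\<forall>\<B>\<in>P. \<forall>A\<in>\<B>. \<forall>A'\<in>\<B>. f A = f A')"

lemma bloc_constantI:
  "(\<And>\<B> A A'. \<B> \<in> P \<Longrightarrow> A \<in> \<B> \<Longrightarrow> A' \<in> \<B> \<Longrightarrow> f A = f A') \<Longrightarrow> bloc_constant P f"
  unfolding bloc_constant_def by (intro ballI)

lemma bloc_constantD:
  "bloc_constant P f \<Longrightarrow> \<B> \<in> P \<Longrightarrow> A \<in> \<B> \<Longrightarrow> A' \<in> \<B> \<Longrightarrow> f A = f A'"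
  unfolding bloc_constant_def by blast

lemma bloc_constant_mult:
  assumes "bloc_constant P f" "bloc_constant P g"
  shows "bloc_constant P (\<lambda>A. f A * g A)"
  by (rule bloc_constantI, rule arg_cong2[where f = "(*)"])
     (rule bloc_constantD[OF assms(1)] bloc_constantD[OF assms(2)], assumption+)+

locale strongly_regular =
  fixes \<Omega> :: "'a set" and P :: "'a set set set"
  assumes finite_ground: "finite \<Omega>"
    and strongly_regular: "strongly_regular_partition \<Omega> P"
begin

lemmas regularity = strongly_regular[unfolded strongly_regular_partition_def]

lemmas blocs_partition = regularity[THEN conjunct1]
lemmas bloc_card = regularity[THEN conjunct2, THEN conjunct1, rule_format]
lemmas bloc_complement = regularity[THEN conjunct2, THEN conjunct2, THEN conjunct1, rule_format]
lemmas bloc_card_below = regularity[THEN conjunct2, THEN conjunct2, THEN conjunct2, rule_format]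

lemma bloc_subset: "\<B> \<in> P \<Longrightarrow> A \<in> \<B> \<Longrightarrow> A \<subseteq> \<Omega>"
  using partition_onD1[OF blocs_partition] by blast

lemma finite_bloc: "\<B> \<in> P \<Longrightarrow> finite \<B>"
  by (rule finite_subset[of _ "Pow \<Omega>"]) (use bloc_subset finite_ground in auto)

lemma finite_blocs: "finite P"
  using finite_elements[OF _ blocs_partition] finite_ground by simp

lemma bloc_constant_cong:
  assumes "bloc_constant P f" and eq: "\<And>A. A \<subseteq> \<Omega> \<Longrightarrow> f A = g A"
  shows "bloc_constant P g"
proof (rule bloc_constantI)
  fix \<B> A A' assume B: "\<B> \<in> P" "A \<in> \<B>" "A' \<in> \<B>"
  then have "A \<subseteq> \<Omega>" "A' \<subseteq> \<Omega>" using bloc_subset by auto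
  with bloc_constantD[OF assms(1) B] show "g A = g A'" by (simp add: eq)
qed

lemma bloc_constant_card: "bloc_constant P (\<lambda>A. h (card A))"
  by (rule bloc_constantI, rule arg_cong[where f = h], rule bloc_card)

lemma bloc_constant_indicator:
  assumes "\<B> \<in> P"
  shows "bloc_constant P (\<lambda>A. if A \<in> \<B> then 1 else 0)"
proof (rule bloc_constantI)
  fix \<C> A A' assume "\<C> \<in> P" "A \<in> \<C>" "A' \<in> \<C>"
  have "X \<in> \<B> \<longleftrightarrow> \<C> = \<B>" if "X \<in> \<C>" for X
    using disjointD[OF partition_onD2[OF blocs_partition] \<open>\<C> \<in> P\<close> assms] that by blast
  with \<open>A \<in> \<C>\<close> \<open>A' \<in> \<C>\<close> have "A \<in> \<B> \<longleftrightarrow> A' \<in> \<B>" by simp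
  then show "(if A \<in> \<B> then 1 else 0) = (if A' \<in> \<B> then 1 else (0::real))" by simp
qed

lemma bloc_constant_complement:
  assumes "bloc_constant P f"
  shows "bloc_constant P (\<lambda>A. f (\<Omega> - A))"
  by (rule bloc_constantI, rule bloc_constantD[OF assms bloc_complement]) blast+

text \<open>
  Grouping the subsets of \<open>A\<close> by their blocs, each bloc contributes the value of \<open>f\<close> on it times
  the number of its members inside \<open>A\<close>, and that number depends only on the bloc of \<open>A\<close>.
\<close>
lemma bloc_constant_sum_subsets:
  assumes f: "bloc_constant P f"
  shows "bloc_constant P (\<lambda>A. \<Sum>D\<in>Pow A. f D)"
proof (rule bloc_constantI)
  define val where "val \<C> = f (SOME D. D \<in> \<C>)" for \<C>
  have val: "f D = val \<C>" if "\<C> \<in> P" "D \<in> \<C>" for \<C> D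
    unfolding val_def by (rule bloc_constantD[OF f that]) (rule someI[of "\<lambda>D. D \<in> \<C>", OF that(2)])
  have grouped: "(\<Sum>D\<in>Pow A. f D) = (\<Sum>\<C>\<in>P. real (card {D \<in> \<C>. D \<subseteq> A}) * val \<C>)"
    if "A \<subseteq> \<Omega>" for A
  proof -
    have "D \<in> \<Union>P" if "D \<subseteq> A" for D
      using that \<open>A \<subseteq> \<Omega>\<close> unfolding partition_onD1[OF blocs_partition, symmetric] by simp
    then have "Pow A = (\<Union>\<C>\<in>P. {D \<in> \<C>. D \<subseteq> A})" by auto
    then have "(\<Sum>D\<in>Pow A. f D) = (\<Sum>D\<in>(\<Union>\<C>\<in>P. {D \<in> \<C>. D \<subseteq> A}). f D)" by simp
    also have "\<dots> = (\<Sum>\<C>\<in>P. \<Sum>D\<in>{D \<in> \<C>. D \<subseteq> A}. f D)"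
    proof (intro sum.UNION_disjoint finite_blocs ballI impI)
      show "finite {D \<in> \<C>. D \<subseteq> A}" if "\<C> \<in> P" for \<C>
        using finite_bloc[OF that] by simp
      show "{D \<in> \<C>. D \<subseteq> A} \<inter> {D \<in> \<D>. D \<subseteq> A} = {}"
        if "\<C> \<in> P" "\<D> \<in> P" "\<C> \<noteq> \<D>" for \<C> \<D>
        using disjointD[OF partition_onD2[OF blocs_partition] that] by blast
    qed
    also have "\<dots> = (\<Sum>\<C>\<in>P. real (card {D \<in> \<C>. D \<subseteq> A}) * val \<C>)"
      by (intro sum.cong refl) (simp add: val)
    finally show ?thesis .
  qed
  fix \<B> A A' assume "\<B> \<in> P" "A \<in> \<B>" "A' \<in> \<B>"
  then show "(\<Sum>D\<in>Pow A. f D) = (\<Sum>D\<in>Pow A'. f D)"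
    using bloc_card_below[of \<B> _ A A'] bloc_subset by (simp add: grouped)
qed

text \<open>
  The supersets of \<open>A\<close> are the complements of the subsets of \<open>\<Omega> - A\<close>, and complements of sets in
  one bloc lie in one bloc.
\<close>
lemma bloc_constant_sum_supersets:
  assumes f: "bloc_constant P f"
  shows "bloc_constant P (\<lambda>A. \<Sum>D | A \<subseteq> D \<and> D \<subseteq> \<Omega>. f D)"
proof -
  have eq: "(\<Sum>D\<in>Pow (\<Omega> - A). f (\<Omega> - D)) = (\<Sum>D | A \<subseteq> D \<and> D \<subseteq> \<Omega>. f D)"
    if "A \<subseteq> \<Omega>" for A
    using that
    by (intro sum.reindex_bij_witness[where i = "\<lambda>D. \<Omega> - D" and j = "\<lambda>D. \<Omega> - D"])
       (auto simp: double_diff)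
  have "bloc_constant P (\<lambda>A. \<Sum>D\<in>Pow (\<Omega> - A). f (\<Omega> - D))"
    by (rule bloc_constant_complement[OF bloc_constant_sum_subsets[OF bloc_constant_complement[OF f]]])
  then show ?thesis using eq by (rule bloc_constant_cong)
qed

text \<open>
  Exchanging the two sums presents the operator as a sum over supersets followed by a sum over
  subsets. The coefficient may depend on the three sizes, because the size is constant on blocs.
\<close>
lemma bloc_constant_sum_common_subsets:
  assumes f: "bloc_constant P f"
  shows "bloc_constant P
    (\<lambda>C. \<Sum>D\<in>Pow \<Omega>. f D * (\<Sum>E\<in>Pow (C \<inter> D). \<phi> (card E) (card C) (card D)))"
proof (rule bloc_constantI)
  fix \<B> C C' assume B: "\<B> \<in> P" "C \<in> \<B>" "C' \<in> \<B>"
  \<comment> \<open>The size of \<open>C'\<close> is that of \<open>C\<close>, so the same coefficient serves both and \<open>T\<close> is a function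
    of \<open>E\<close> alone.\<close>
  define T where "T E = (\<Sum>D | E \<subseteq> D \<and> D \<subseteq> \<Omega>. f D * \<phi> (card E) (card C) (card D))" for E
  have T: "bloc_constant P T"
  proof (rule bloc_constantI)
    fix \<C> E E' assume E: "\<C> \<in> P" "E \<in> \<C>" "E' \<in> \<C>"
    have "bloc_constant P (\<lambda>D. f D * \<phi> (card E) (card C) (card D))"
      by (intro bloc_constant_mult f bloc_constant_card)
    from bloc_constantD[OF bloc_constant_sum_supersets[OF this] E]
    show "T E = T E'"
      unfolding T_def using bloc_card[OF E] by simp
  qed
  have exchange: "(\<Sum>D\<in>Pow \<Omega>. f D * (\<Sum>E\<in>Pow (X \<inter> D). \<phi> (card E) (card C) (card D)))
      = (\<Sum>E\<in>Pow X. T E)" if "X \<subseteq> \<Omega>" for X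
  proof -
    have "(\<Sum>D\<in>Pow \<Omega>. f D * (\<Sum>E\<in>Pow (X \<inter> D). \<phi> (card E) (card C) (card D)))
        = (\<Sum>D\<in>Pow \<Omega>. \<Sum>E\<in>{E\<in>Pow X. E \<subseteq> D}. f D * \<phi> (card E) (card C) (card D))"
      by (intro sum.cong refl) (auto simp: sum_distrib_left intro!: sum.cong)
    also have "\<dots> = (\<Sum>E\<in>Pow X. \<Sum>D\<in>{D\<in>Pow \<Omega>. E \<subseteq> D}. f D * \<phi> (card E) (card C) (card D))"
      using that finite_ground finite_subset by (intro sum.swap_restrict) auto
    also have "\<dots> = (\<Sum>E\<in>Pow X. T E)"
      unfolding T_def by (intro sum.cong refl) auto
    finally show ?thesis .
  qed
  have "(\<Sum>E\<in>Pow C. T E) = (\<Sum>E\<in>Pow C'. T E)"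
    using bloc_constantD[OF bloc_constant_sum_subsets[OF T] B] .
  then show "(\<Sum>D\<in>Pow \<Omega>. f D * (\<Sum>E\<in>Pow (C \<inter> D). \<phi> (card E) (card C) (card D)))
      = (\<Sum>D\<in>Pow \<Omega>. f D * (\<Sum>E\<in>Pow (C' \<inter> D). \<phi> (card E) (card C') (card D)))"
    using exchange B bloc_subset bloc_card[OF B] by simp
qed

end

section \<open>Product kernels\<close>

definition product_kernel :: "real \<Rightarrow> real \<Rightarrow> 'a set \<Rightarrow> 'a set \<Rightarrow> real" where
  "product_kernel p q A D = p ^ card (A \<inter> D) * q ^ card (A - D)"

text \<open>
  Expand the product of \<open>(p - q) + q\<close> over \<open>A \<inter> D\<close>; the factors \<open>q\<close> from \<open>A - D\<close> join those
  from \<open>A \<inter> D\<close> outside \<open>E\<close>, so that \<open>D\<close> survives only in the range of \<open>E\<close>.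
\<close>
lemma product_kernel_expand:
  assumes "finite A"
  shows "product_kernel p q A D = (\<Sum>E\<in>Pow (A \<inter> D). (p - q) ^ card E * q ^ (card A - card E))"
proof -
  have fin: "finite (A \<inter> D)" using assms by simp
  have "p ^ card (A \<inter> D) = (\<Prod>e\<in>A \<inter> D. (p - q) + q)" by simp
  also have "\<dots> = (\<Sum>E\<in>Pow (A \<inter> D). (p - q) ^ card E * q ^ card (A \<inter> D - E))"
    by (subst prod_add[OF fin]) simp
  finally have "product_kernel p q A D
      = (\<Sum>E\<in>Pow (A \<inter> D). (p - q) ^ card E * (q ^ card (A \<inter> D - E) * q ^ card (A - D)))"
    unfolding product_kernel_def by (simp add: sum_distrib_right mult.assoc)
  also have "\<dots> = (\<Sum>E\<in>Pow (A \<inter> D). (p - q) ^ card E * q ^ (card A - card E))"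
  proof (intro sum.cong refl arg_cong2[where f = "(*)"])
    fix E assume E: "E \<in> Pow (A \<inter> D)"
    then have "finite E" using fin finite_subset by blast
    have "card (A \<inter> D - E) + card (A - D) = card ((A \<inter> D - E) \<union> (A - D))"
      using assms by (subst card_Un_disjoint) auto
    also have "(A \<inter> D - E) \<union> (A - D) = A - E" using E by blast
    also have "card (A - E) = card A - card E"
      using E \<open>finite E\<close> by (intro card_Diff_subset) auto
    finally show "q ^ card (A \<inter> D - E) * q ^ card (A - D) = q ^ (card A - card E)"
      by (simp flip: power_add)
  qed
  finally show ?thesis .
qed

context strongly_regular
begin

lemma bloc_constant_kernel_left:
  assumes "bloc_constant P f"
  shows "bloc_constant P (\<lambda>D. \<Sum>A\<in>Pow \<Omega>. f A * product_kernel p q A D)"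
proof -
  have "bloc_constant P (\<lambda>D. \<Sum>A\<in>Pow \<Omega>. f A *
      (\<Sum>E\<in>Pow (D \<inter> A). (p - q) ^ card E * q ^ (card A - card E)))"
    by (rule bloc_constant_sum_common_subsets[OF assms, where \<phi> = "\<lambda>e d a. (p - q) ^ e * q ^ (a - e)"])
  also have "(\<lambda>D. \<Sum>A\<in>Pow \<Omega>. f A *
      (\<Sum>E\<in>Pow (D \<inter> A). (p - q) ^ card E * q ^ (card A - card E)))
    = (\<lambda>D. \<Sum>A\<in>Pow \<Omega>. f A * product_kernel p q A D)"
    using finite_ground
    by (intro ext sum.cong refl) (auto simp: product_kernel_expand finite_subset Int_commute)
  finally show ?thesis .
qed

lemma bloc_constant_kernel_right:
  assumes "bloc_constant P f"
  shows "bloc_constant P (\<lambda>C. \<Sum>D\<in>Pow \<Omega>. f D * product_kernel p q C D)"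
proof -
  have "bloc_constant P (\<lambda>C. \<Sum>D\<in>Pow \<Omega>. f D *
      (\<Sum>E\<in>Pow (C \<inter> D). (p - q) ^ card E * q ^ (card C - card E)))"
    by (rule bloc_constant_sum_common_subsets[OF assms, where \<phi> = "\<lambda>e c d. (p - q) ^ e * q ^ (c - e)"])
  then show ?thesis
    by (rule bloc_constant_cong)
       (simp add: product_kernel_expand finite_subset[OF _ finite_ground])
qed

end

section \<open>Star to triangle\<close>

text \<open>
  If a random variable with two values has mean \<open>0\<close> and variance \<open>1\<close>, then its values are the roots
  of \<open>\<rho>\<^sup>2 = s * \<rho> + 1\<close>, where \<open>s\<close> is the third
  moment: multiply the equation by \<open>\<rho>\<close> and take means.
  The roots are \<open>r\<close> and \<open>- 1 / r\<close> with \<open>s = r - 1 / r\<close>, and every real skewness \<open>s\<close> occurs.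
\<close>
lemma two_point_moments:
  fixes s :: real
  obtains u u' \<rho> \<rho>' where "u + u' = 1" "u * \<rho> + u' * \<rho>' = 0"
    "u * \<rho>\<^sup>2 + u' * \<rho>'\<^sup>2 = 1" "u * \<rho>^3 + u' * \<rho>'^3 = s"
proof -
  define r where "r = (s + sqrt (s\<^sup>2 + 4)) / 2"
  have "\<bar>s\<bar> < sqrt (s\<^sup>2 + 4)"
    by (rule real_less_rsqrt) simp
  then have "r > 0" unfolding r_def by simp
  have "2 * r - s = sqrt (s\<^sup>2 + 4)" unfolding r_def by (simp add: field_simps)
  then have "(2 * r - s)\<^sup>2 = s\<^sup>2 + 4" by simp
  then have root: "r\<^sup>2 - 1 = s * r" by (simp add: power2_eq_square algebra_simps)
  have pos: "1 + r\<^sup>2 > 0" by (simp add: add_pos_nonneg)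
  show ?thesis
  proof (rule that[of "1 / (1 + r\<^sup>2)" "r\<^sup>2 / (1 + r\<^sup>2)" r "- 1 / r"])
    show "1 / (1 + r\<^sup>2) + r\<^sup>2 / (1 + r\<^sup>2) = 1"
      using pos by (simp flip: add_divide_distrib)
    show "1 / (1 + r\<^sup>2) * r + r\<^sup>2 / (1 + r\<^sup>2) * (- 1 / r) = 0"
      using \<open>r > 0\<close> by (simp add: power2_eq_square)
    have "r\<^sup>2 / (1 + r\<^sup>2) * (- 1 / r)\<^sup>2 = 1 / (1 + r\<^sup>2)"
      using \<open>r > 0\<close> by (simp add: power_divide)
    then show "1 / (1 + r\<^sup>2) * r\<^sup>2 + r\<^sup>2 / (1 + r\<^sup>2) * (- 1 / r)\<^sup>2 = 1"
      using pos by (simp flip: add_divide_distrib)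
    have "r\<^sup>2 / (1 + r\<^sup>2) * (- 1 / r)^3 = - (1 / r) / (1 + r\<^sup>2)"
      using \<open>r > 0\<close> by (simp add: power_divide power2_eq_square power3_eq_cube)
    then have "1 / (1 + r\<^sup>2) * r^3 + r\<^sup>2 / (1 + r\<^sup>2) * (- 1 / r)^3 = (r^3 - 1 / r) / (1 + r\<^sup>2)"
      by (simp add: diff_divide_distrib)
    also have "r^3 - 1 / r = (r\<^sup>2 - 1) * (1 + r\<^sup>2) / r"
      using \<open>r > 0\<close> by (simp add: field_simps power2_eq_square power3_eq_cube)
    also have "(r\<^sup>2 - 1) * (1 + r\<^sup>2) / r / (1 + r\<^sup>2) = s"
      using pos \<open>r > 0\<close> by (simp add: root)
    finally show "1 / (1 + r\<^sup>2) * r^3 + r\<^sup>2 / (1 + r\<^sup>2) * (- 1 / r)^3 = s" .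
  qed
qed

text \<open>
  Decomposition of a \<open>2 \<times> 2 \<times> 2\<close> tensor into two rank-one terms, read as a moment problem: find
  three random variables on a common two-point space with means \<open>1\<close>, with pairwise mixed moments
  \<open>x\<close>, \<open>y\<close>, \<open>z\<close> and with triple moment \<open>t\<close>. Any nonconstant variable on two points is an affine
  function of the standardised one \<open>\<rho>\<close>, so the three are \<open>1 + \<alpha> * \<rho>\<close>, \<open>1 + \<beta> * \<rho>\<close> and
  \<open>1 + \<gamma> * \<rho>\<close>. The pairwise moments determine \<open>\<alpha>\<close>, \<open>\<beta>\<close>, \<open>\<gamma>\<close> up to a common sign, and the triple
  moment then fixes the skewness of \<open>\<rho>\<close>.
\<close>
lemma two_point_joint_moments:
  fixes x y z t :: real
  assumes "x > 1" "y > 1" "z > 1"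
  obtains u u' a a' b b' c c' where
    "u + u' = 1"
    "u * a + u' * a' = 1" "u * b + u' * b' = 1" "u * c + u' * c' = 1"
    "u * (a * b) + u' * (a' * b') = x" "u * (a * c) + u' * (a' * c') = y"
    "u * (b * c) + u' * (b' * c') = z" "u * (a * b * c) + u' * (a' * b' * c') = t"
proof -
  define k where "k = sqrt ((x - 1) * (y - 1) * (z - 1))"
  have k: "k > 0" "k\<^sup>2 = (x - 1) * (y - 1) * (z - 1)"
    using assms unfolding k_def by simp_all
  \<comment> \<open>The products of two of the three unknowns are prescribed, and \<open>k\<close> is the product of all three.\<close>
  define \<alpha> \<beta> \<gamma> where "\<alpha> = k / (z - 1)" and "\<beta> = k / (y - 1)" and "\<gamma> = k / (x - 1)"
  have pairs: "\<alpha> * \<beta> = x - 1" "\<alpha> * \<gamma> = y - 1" "\<beta> * \<gamma> = z - 1"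
  proof -
    have "\<alpha> * \<beta> = k\<^sup>2 / ((z - 1) * (y - 1))" "\<alpha> * \<gamma> = k\<^sup>2 / ((z - 1) * (x - 1))"
      "\<beta> * \<gamma> = k\<^sup>2 / ((y - 1) * (x - 1))"
      unfolding \<alpha>_def \<beta>_def \<gamma>_def by (simp_all add: power2_eq_square)
    then show "\<alpha> * \<beta> = x - 1" "\<alpha> * \<gamma> = y - 1" "\<beta> * \<gamma> = z - 1"
      using assms unfolding k(2) by simp_all
  qed
  have "\<alpha> * \<beta> * \<gamma> \<noteq> 0" using k(1) assms unfolding \<alpha>_def \<beta>_def \<gamma>_def by simp
  define s where "s = (t - 1 - \<alpha> * \<beta> - \<alpha> * \<gamma> - \<beta> * \<gamma>) / (\<alpha> * \<beta> * \<gamma>)"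
  have s: "\<alpha> * \<beta> * \<gamma> * s = t - 1 - \<alpha> * \<beta> - \<alpha> * \<gamma> - \<beta> * \<gamma>"
    using \<open>\<alpha> * \<beta> * \<gamma> \<noteq> 0\<close> unfolding s_def by simp
  obtain u u' \<rho> \<rho>' where m: "u + u' = 1" "u * \<rho> + u' * \<rho>' = 0"
    "u * \<rho>\<^sup>2 + u' * \<rho>'\<^sup>2 = 1" "u * \<rho>^3 + u' * \<rho>'^3 = s"
    by (rule two_point_moments)
  have one: "u * (1 + \<xi> * \<rho>) + u' * (1 + \<xi> * \<rho>') = 1" for \<xi>
  proof -
    have "u * (1 + \<xi> * \<rho>) + u' * (1 + \<xi> * \<rho>') = (u + u') + \<xi> * (u * \<rho> + u' * \<rho>')"
      by (simp add: algebra_simps)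
    then show ?thesis by (simp add: m)
  qed
  have two: "u * ((1 + \<xi> * \<rho>) * (1 + \<eta> * \<rho>)) + u' * ((1 + \<xi> * \<rho>') * (1 + \<eta> * \<rho>')) = 1 + \<xi> * \<eta>"
    for \<xi> \<eta>
  proof -
    have "u * ((1 + \<xi> * \<rho>) * (1 + \<eta> * \<rho>)) + u' * ((1 + \<xi> * \<rho>') * (1 + \<eta> * \<rho>'))
      = (u + u') + (\<xi> + \<eta>) * (u * \<rho> + u' * \<rho>') + \<xi> * \<eta> * (u * \<rho>\<^sup>2 + u' * \<rho>'\<^sup>2)"
      by (simp add: algebra_simps power2_eq_square)
    then show ?thesis by (simp add: m)
  qed
  have "u * ((1 + \<alpha> * \<rho>) * (1 + \<beta> * \<rho>) * (1 + \<gamma> * \<rho>))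
        + u' * ((1 + \<alpha> * \<rho>') * (1 + \<beta> * \<rho>') * (1 + \<gamma> * \<rho>'))
      = (u + u') + (\<alpha> + \<beta> + \<gamma>) * (u * \<rho> + u' * \<rho>')
        + (\<alpha> * \<beta> + \<alpha> * \<gamma> + \<beta> * \<gamma>) * (u * \<rho>\<^sup>2 + u' * \<rho>'\<^sup>2)
        + \<alpha> * \<beta> * \<gamma> * (u * \<rho>^3 + u' * \<rho>'^3)"
    by (simp add: algebra_simps power2_eq_square power3_eq_cube)
  then have three: "u * ((1 + \<alpha> * \<rho>) * (1 + \<beta> * \<rho>) * (1 + \<gamma> * \<rho>))
      + u' * ((1 + \<alpha> * \<rho>') * (1 + \<beta> * \<rho>') * (1 + \<gamma> * \<rho>')) = t"
    by (simp add: m s)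
  show ?thesis
    by (rule that[OF m(1) one one one _ _ _ three]) (simp_all add: two pairs)
qed

lemma card_power_eq_prod:
  fixes p :: real
  assumes "finite \<Omega>" "A \<subseteq> \<Omega>"
  shows "p ^ card A = (\<Prod>e\<in>\<Omega>. if e \<in> A then p else 1)"
  using assms by (simp add: prod.If_cases Int_absorb1)

text \<open>
  The sum over \<open>D\<close> of a product of local factors is the product over the points of the sum of the
  two local factors, one for membership in \<open>D\<close> and one for nonmembership. The moment hypotheses
  evaluate this sum for each of the eight positions of a point relative to \<open>A\<close>, \<open>B\<close> and \<open>C\<close>. A
  point in all three sets also counts in each pairwise intersection, whence the triple moment
  \<open>x * y * z * v\<close> rather than \<open>v\<close>.
\<close>
lemma star_triangle:
  fixes x y z v :: real
  assumes "finite \<Omega>" and sub: "A \<subseteq> \<Omega>" "B \<subseteq> \<Omega>" "C \<subseteq> \<Omega>"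
    and "u + u' = 1"
    and "u * a + u' * a' = 1" "u * b + u' * b' = 1" "u * c + u' * c' = 1"
    and "u * (a * b) + u' * (a' * b') = x" "u * (a * c) + u' * (a' * c') = y"
    and "u * (b * c) + u' * (b' * c') = z" "u * (a * b * c) + u' * (a' * b' * c') = x * y * z * v"
  shows "(\<Sum>D\<in>Pow \<Omega>. u ^ card D * u' ^ card (\<Omega> - D) * product_kernel a a' A D
            * product_kernel b b' B D * product_kernel c c' C D)
       = x ^ card (A \<inter> B) * y ^ card (A \<inter> C) * z ^ card (B \<inter> C) * v ^ card (A \<inter> B \<inter> C)"
proof -
  define w where "w p X e = (if e \<in> X then p else (1::real))" for p X and e :: 'a
  have pow: "p ^ card X = (\<Prod>e\<in>\<Omega>. w p X e)" if "X \<subseteq> \<Omega>" for p X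
    unfolding w_def using card_power_eq_prod[OF \<open>finite \<Omega>\<close> that] .
  have kernel: "product_kernel p q X D = (\<Prod>e\<in>D. w p X e) * (\<Prod>e\<in>\<Omega> - D. w q X e)"
    if "X \<subseteq> \<Omega>" "D \<subseteq> \<Omega>" for p q X D
  proof -
    have fin: "finite D" "finite (\<Omega> - D)" using that \<open>finite \<Omega>\<close> finite_subset by auto
    have "(\<Prod>e\<in>D. w p X e) = p ^ card (X \<inter> D)"
      unfolding w_def using fin by (simp add: prod.If_cases Int_commute)
    moreover have "(\<Prod>e\<in>\<Omega> - D. w q X e) = q ^ card (X - D)"
    proof -
      have "(\<Omega> - D) \<inter> X = X - D" using that by blast
      then show ?thesis unfolding w_def using fin by (simp add: prod.If_cases)
    qed
    ultimately show ?thesis unfolding product_kernel_def by simp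
  qed
  have "(\<Sum>D\<in>Pow \<Omega>. u ^ card D * u' ^ card (\<Omega> - D) * product_kernel a a' A D
            * product_kernel b b' B D * product_kernel c c' C D)
      = (\<Sum>D\<in>Pow \<Omega>. (\<Prod>e\<in>D. u * w a A e * w b B e * w c C e)
            * (\<Prod>e\<in>\<Omega> - D. u' * w a' A e * w b' B e * w c' C e))"
    by (intro sum.cong refl) (simp add: kernel sub prod.distrib mult_ac)
  also have "\<dots> = (\<Prod>e\<in>\<Omega>. u * w a A e * w b B e * w c C e + u' * w a' A e * w b' B e * w c' C e)"
    by (rule prod_add[OF \<open>finite \<Omega>\<close>, symmetric])
  also have "\<dots> = (\<Prod>e\<in>\<Omega>. w x (A \<inter> B) e * w y (A \<inter> C) e * w z (B \<inter> C) e * w v (A \<inter> B \<inter> C) e)"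
    unfolding w_def using assms(5-) by (intro prod.cong refl) (auto simp: mult_ac)
  also have "\<dots> = x ^ card (A \<inter> B) * y ^ card (A \<inter> C) * z ^ card (B \<inter> C) * v ^ card (A \<inter> B \<inter> C)"
    using sub by (subst (1 2 3 4) pow) (auto simp: prod.distrib)
  finally show ?thesis .
qed

context strongly_regular
begin

text \<open>
  For fixed \<open>D\<close> the star factors into a sum over \<open>A\<close>, a sum over \<open>B\<close> and a weight depending on the
  size of \<open>D\<close>. Each is constant on blocs as a function of \<open>D\<close>, hence so is their product \<open>g\<close>, and
  the leg from \<open>D\<close> to \<open>C\<close> is one more kernel operator.
\<close>
lemma generating_function_bloc_constant:
  fixes x y z v :: real
  assumes blocs: "Bi \<in> P" "Bj \<in> P" "Bk \<in> P" "C \<in> Bk" "C' \<in> Bk"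
    and gt: "x > 1" "y > 1" "z > 1"
  shows "(\<Sum>(A, B)\<in>Bi \<times> Bj. x ^ card (A \<inter> B) * y ^ card (A \<inter> C) * z ^ card (B \<inter> C) * v ^ card (A \<inter> B \<inter> C))
       = (\<Sum>(A, B)\<in>Bi \<times> Bj. x ^ card (A \<inter> B) * y ^ card (A \<inter> C') * z ^ card (B \<inter> C') * v ^ card (A \<inter> B \<inter> C'))"
proof -
  obtain u u' a a' b b' c c' where m:
    "u + u' = 1"
    "u * a + u' * a' = 1" "u * b + u' * b' = 1" "u * c + u' * c' = 1"
    "u * (a * b) + u' * (a' * b') = x" "u * (a * c) + u' * (a' * c') = y"
    "u * (b * c) + u' * (b' * c') = z" "u * (a * b * c) + u' * (a' * b' * c') = x * y * z * v"
    using two_point_joint_moments[OF gt] by metis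
  define F where "F p q \<B> D = (\<Sum>A\<in>\<B>. product_kernel p q A D)" for p q and \<B> :: "'a set set" and D
  have F: "bloc_constant P (F p q \<B>)" if "\<B> \<in> P" for p q \<B>
  proof -
    have "F p q \<B> D = (\<Sum>A\<in>Pow \<Omega>. (if A \<in> \<B> then 1 else 0) * product_kernel p q A D)" for D
      unfolding F_def using bloc_subset[OF that] finite_ground
      by (intro sum.mono_neutral_cong_left) auto
    then show ?thesis
      using bloc_constant_kernel_left[OF bloc_constant_indicator[OF that]] by presburger
  qed
  define g where "g D = u ^ card D * u' ^ (card \<Omega> - card D) * F a a' Bi D * F b b' Bj D" for D
  have g: "bloc_constant P g"
    unfolding g_def by (intro bloc_constant_mult F blocs bloc_constant_card)
  have star: "(\<Sum>(A, B)\<in>Bi \<times> Bj. x ^ card (A \<inter> B) * y ^ card (A \<inter> X) * z ^ card (B \<inter> X) * v ^ card (A \<inter> B \<inter> X))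
      = (\<Sum>D\<in>Pow \<Omega>. g D * product_kernel c c' X D)" if "X \<subseteq> \<Omega>" for X
  proof -
    have "(\<Sum>(A, B)\<in>Bi \<times> Bj. x ^ card (A \<inter> B) * y ^ card (A \<inter> X) * z ^ card (B \<inter> X) * v ^ card (A \<inter> B \<inter> X))
      = (\<Sum>(A, B)\<in>Bi \<times> Bj. \<Sum>D\<in>Pow \<Omega>. u ^ card D * u' ^ card (\<Omega> - D) * product_kernel a a' A D
            * product_kernel b b' B D * product_kernel c c' X D)"
      using star_triangle[OF finite_ground _ _ that m] bloc_subset blocs
      by (intro sum.cong refl) auto
    also have "\<dots> = (\<Sum>D\<in>Pow \<Omega>. \<Sum>(A, B)\<in>Bi \<times> Bj. u ^ card D * u' ^ card (\<Omega> - D) * product_kernel a a' A D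
            * product_kernel b b' B D * product_kernel c c' X D)"
      unfolding split_def by (rule sum.swap)
    also have "\<dots> = (\<Sum>D\<in>Pow \<Omega>. g D * product_kernel c c' X D)"
    proof (intro sum.cong refl)
      fix D assume "D \<in> Pow \<Omega>"
      then have "card (\<Omega> - D) = card \<Omega> - card D"
        using finite_ground by (simp add: card_Diff_subset finite_subset)
      then show "(\<Sum>(A, B)\<in>Bi \<times> Bj. u ^ card D * u' ^ card (\<Omega> - D) * product_kernel a a' A D
            * product_kernel b b' B D * product_kernel c c' X D) = g D * product_kernel c c' X D"
        unfolding g_def F_def
        by (simp add: sum.cartesian_product[symmetric] sum_distrib_left sum_distrib_right mult_ac)
    qed
    finally show ?thesis .
  qed
  show ?thesis
    using bloc_constantD[OF bloc_constant_kernel_right[OF g] blocs(3-5)] star bloc_subset blocs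
    by simp
qed

end

section \<open>Extracting coefficients\<close>

text \<open>
  Both sums are polynomials in \<open>x\<close>, and they agree at infinitely many points. Using arbitrary
  coefficients \<open>Q\<close> and different index sets on the two sides allows several variables to be treated
  one after another.
\<close>
lemma sum_power_coefficients_eq:
  fixes Q :: "'b \<Rightarrow> real" and Q' :: "'c \<Rightarrow> real"
  assumes fin: "finite S" "finite S'" and "infinite X"
    and eq: "\<And>x. x \<in> X \<Longrightarrow> (\<Sum>\<sigma>\<in>S. x ^ m \<sigma> * Q \<sigma>) = (\<Sum>\<sigma>\<in>S'. x ^ m' \<sigma> * Q' \<sigma>)"
  shows "(\<Sum>\<sigma> | \<sigma> \<in> S \<and> m \<sigma> = n. Q \<sigma>) = (\<Sum>\<sigma> | \<sigma> \<in> S' \<and> m' \<sigma> = n. Q' \<sigma>)"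
proof -
  define p where "p = (\<Sum>\<sigma>\<in>S. monom (Q \<sigma>) (m \<sigma>)) - (\<Sum>\<sigma>\<in>S'. monom (Q' \<sigma>) (m' \<sigma>))"
  have "poly p x = 0" if "x \<in> X" for x
    unfolding p_def using eq[OF that] by (simp add: poly_sum poly_monom mult.commute)
  then have "p = 0"
    using \<open>infinite X\<close> poly_roots_finite[of p] finite_subset[of X "{x. poly p x = 0}"] by auto
  then have "coeff p n = 0" by simp
  then show ?thesis
    unfolding p_def using fin by (simp add: coeff_sum sum.If_cases Int_def)
qed

text \<open>
  The factors are nested, with a trailing \<open>1\<close>, so that after each extraction of a coefficient what
  remains is again a power of the next variable times a coefficient.
\<close>
lemma card_eq_if_generating_function_eq:
  fixes f1 f2 f3 f4 :: "'b \<Rightarrow> nat" and g1 g2 g3 g4 :: "'c \<Rightarrow> nat"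
  assumes fin: "finite S" "finite S'" and X: "infinite (X :: real set)"
    and eq: "\<And>x y z v. \<lbrakk>x \<in> X; y \<in> X; z \<in> X; v \<in> X\<rbrakk> \<Longrightarrow>
      (\<Sum>\<sigma>\<in>S. x ^ f1 \<sigma> * (y ^ f2 \<sigma> * (z ^ f3 \<sigma> * (v ^ f4 \<sigma> * 1))))
        = (\<Sum>\<sigma>\<in>S'. x ^ g1 \<sigma> * (y ^ g2 \<sigma> * (z ^ g3 \<sigma> * (v ^ g4 \<sigma> * 1))))"
  shows "card {\<sigma> \<in> S. f1 \<sigma> = n1 \<and> f2 \<sigma> = n2 \<and> f3 \<sigma> = n3 \<and> f4 \<sigma> = n4}
       = card {\<sigma> \<in> S'. g1 \<sigma> = n1 \<and> g2 \<sigma> = n2 \<and> g3 \<sigma> = n3 \<and> g4 \<sigma> = n4}"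
proof -
  note compare_coefficients = sum_power_coefficients_eq[OF _ _ X]
  have "(\<Sum>\<sigma> | \<sigma> \<in> {\<sigma> \<in> {\<sigma> \<in> {\<sigma> \<in> S. f1 \<sigma> = n1}. f2 \<sigma> = n2}. f3 \<sigma> = n3} \<and> f4 \<sigma> = n4. 1 :: real)
      = (\<Sum>\<sigma> | \<sigma> \<in> {\<sigma> \<in> {\<sigma> \<in> {\<sigma> \<in> S'. g1 \<sigma> = n1}. g2 \<sigma> = n2}. g3 \<sigma> = n3} \<and> g4 \<sigma> = n4. 1)"
    \<comment> \<open>Each round treats one variable, the innermost comprehension belonging to the first one.\<close>
    by (rule compare_coefficients, use fin in simp, use fin in simp)+ (rule eq)
  then show ?thesis by (simp add: conj_assoc)
qed

theorem theorem2:
  fixes \<Omega> :: "'a set" and P :: "'a set set set"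
    and Bi Bj Bk :: "'a set set" and r1 r2 r3 r4 :: int
  assumes "finite \<Omega>"
    and "strongly_regular_partition \<Omega> P"
    and "Bi \<in> P" and "Bj \<in> P" and "Bk \<in> P"
  shows "\<forall>C\<in>Bk. \<forall>C'\<in>Bk.
    card {(A, B) \<in> Bi \<times> Bj. int (card (A \<inter> B)) = r1 \<and> int (card (A \<inter> C)) = r2 \<and>
                          int (card (B \<inter> C)) = r3 \<and> int (card (A \<inter> B \<inter> C)) = r4}
  = card {(A, B) \<in> Bi \<times> Bj. int (card (A \<inter> B)) = r1 \<and> int (card (A \<inter> C')) = r2 \<and>
                          int (card (B \<inter> C')) = r3 \<and> int (card (A \<inter> B \<inter> C')) = r4}"
proof (intro ballI)
  interpret strongly_regular \<Omega> P
    using assms(1,2) by unfold_locales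
  fix C C' assume C: "C \<in> Bk" "C' \<in> Bk"
  show "card {(A, B) \<in> Bi \<times> Bj. int (card (A \<inter> B)) = r1 \<and> int (card (A \<inter> C)) = r2 \<and>
                          int (card (B \<inter> C)) = r3 \<and> int (card (A \<inter> B \<inter> C)) = r4}
  = card {(A, B) \<in> Bi \<times> Bj. int (card (A \<inter> B)) = r1 \<and> int (card (A \<inter> C')) = r2 \<and>
                          int (card (B \<inter> C')) = r3 \<and> int (card (A \<inter> B \<inter> C')) = r4}"
  proof (cases "r1 \<ge> 0 \<and> r2 \<ge> 0 \<and> r3 \<ge> 0 \<and> r4 \<ge> 0")
    case True
    then obtain n1 n2 n3 n4 where r: "r1 = int n1" "r2 = int n2" "r3 = int n3" "r4 = int n4"
      by (metis nonneg_eq_int)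
    have "finite (Bi \<times> Bj)"
      using assms(3,4) finite_bloc by simp
    moreover have "infinite {1 :: real<..}"
      by (rule infinite_Ioi)
    ultimately have "card {\<sigma> \<in> Bi \<times> Bj. card (fst \<sigma> \<inter> snd \<sigma>) = n1 \<and> card (fst \<sigma> \<inter> C) = n2 \<and>
          card (snd \<sigma> \<inter> C) = n3 \<and> card (fst \<sigma> \<inter> snd \<sigma> \<inter> C) = n4}
      = card {\<sigma> \<in> Bi \<times> Bj. card (fst \<sigma> \<inter> snd \<sigma>) = n1 \<and> card (fst \<sigma> \<inter> C') = n2 \<and>
          card (snd \<sigma> \<inter> C') = n3 \<and> card (fst \<sigma> \<inter> snd \<sigma> \<inter> C') = n4}"
      using generating_function_bloc_constant[OF assms(3-5) C]
      by (intro card_eq_if_generating_function_eq[where X = "{1<..}"]) (auto simp: split_def mult_ac)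
    then show ?thesis
      by (simp add: r split_def mem_Times_iff)
  next
    case False
    \<comment> \<open>No cardinality is negative, so both sets are empty.\<close>
    then show ?thesis by (intro arg_cong[where f = card]) auto
  qed
qed

end
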